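(* Let $k$ be a negative real number, let $g(x)=k$ (a constant polynomial), and let $d(x)$ be a nonconstant polynomial. Let $\{\mathcal{F}_n(x)\}_{n\ge 0}$ and $\{\mathcal{L}_n(x)\}_{n\ge 0}$ be the Fibonacci-type and Lucas-type generalized Fibonacci polynomials determined by $d(x)$ and $g(x)$. Suppose there are real constants $s_1,s_2$ such that $d(s_1)=-\sqrt{-4k}$ and $d(s_2)=\sqrt{-4k}$, and such that $4k+d^2(x)\le 0$ for every $x$ in the closed interval with endpoints $s_1$ and $s_2$. Then for all nonnegative integers $n\neq m$, $$\int_{s_1}^{s_2}\mathcal{F}_n(x)\mathcal{F}_m(x)\sqrt{-4k-d^2(x)}\;d'(x)\,dx=0$$ and $$\int_{s_1}^{s_2}\frac{\mathcal{L}_n(x)\mathcal{L}_m(x)}{\sqrt{-4k-d^2(x)}}\;d'(x)\,dx=0.$$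
   Context: Generalized Fibonacci polynomials (GFP): fix nonzero polynomials $d(x)\in\mathbb{Q}[x]$ and $g(x)$ with $\deg d>\deg g$ (here $g$ is a real constant). The Fibonacci-type sequence is $\mathcal{F}_0(x)=0$, $\mathcal{F}_1(x)=1$, $\mathcal{F}_n(x)=d(x)\mathcal{F}_{n-1}(x)+g(x)\mathcal{F}_{n-2}(x)$ for $n\ge 2$. The Lucas-type sequence is $\mathcal{L}_0(x)=p_0$, $\mathcal{L}_1(x)=p_1(x)$, $\mathcal{L}_n(x)=d(x)\mathcal{L}_{n-1}(x)+g(x)\mathcal{L}_{n-2}(x)$ for $n\ge2$, where $p_0\in\{\pm1,\pm2\}$, $\alpha=2/p_0$, and $d(x)=\alpha p_1(x)$. Integrals are oriented (if $s_2<s_1$, $\int_{s_1}^{s_2}=-\int_{s_2}^{s_1}$), and the integrand of the second integral is only considered off the finite set where its denominator vanishes. *)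

theory Defs
  imports "HOL-Analysis.Analysis" "HOL-Computational_Algebra.Polynomial"
begin

fun gfp :: "real poly \<Rightarrow> real poly \<Rightarrow> real poly \<Rightarrow> real poly \<Rightarrow> nat \<Rightarrow> real poly" where
  "gfp q0 q1 d g 0 = q0"
| "gfp q0 q1 d g (Suc 0) = q1"
| "gfp q0 q1 d g (Suc (Suc n)) = d * gfp q0 q1 d g (Suc n) + g * gfp q0 q1 d g n"

definition fibonacci_gfp :: "real poly \<Rightarrow> real poly \<Rightarrow> nat \<Rightarrow> real poly" where
  "fibonacci_gfp d g = gfp 0 1 d g"

(* The side conditions on the Lucas type, p0 in {1, -1, 2, -2} and d = (2 / p0) p1,
   are kept apart as a predicate because they only relate the parameters. *)
definition lucas_params :: "real \<Rightarrow> real poly \<Rightarrow> real poly \<Rightarrow> bool" where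
  "lucas_params p0 p1 d \<longleftrightarrow> p0 \<in> {1, -1, 2, -2} \<and> d = smult (2 / p0) p1"

definition lucas_gfp :: "real \<Rightarrow> real poly \<Rightarrow> real poly \<Rightarrow> real poly \<Rightarrow> nat \<Rightarrow> real poly" where
  "lucas_gfp p0 p1 d g = gfp [:p0:] p1 d g"

(* The oriented integral of f from a to b exists and equals v. The existence part is needed
   because the library integral of a non-integrable function is 0 by convention.
   Integration is over the open interval between a and b, so neither the endpoints nor
   finitely many interior points (where a quotient may take the junk value x / 0 = 0) matter. *)
definition has_oriented_integral :: "(real \<Rightarrow> real) \<Rightarrow> real \<Rightarrow> real \<Rightarrow> real \<Rightarrow> bool" where
  "has_oriented_integral f a b v \<longleftrightarrow>
     interval_lebesgue_integrable lborel (ereal a) (ereal b) f \<and>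
     interval_lebesgue_integral lborel (ereal a) (ereal b) f = v"

end

theory Submission
  imports Defs
begin

text \<open>
  Put \<open>R = sqrt (- 4 * k) = 2 * r\<close> and substitute \<open>d(x) = R * cos t\<close>, that is
  \<open>t = arccos (d(x) / R)\<close>.  Then \<open>sin t * r * F\<^sub>n(x) = r^n * sin (n * t)\<close> and
  \<open>L\<^sub>n(x) = p0 * r^n * cos (n * t)\<close>, while \<open>d'(x) / sqrt (R\<^sup>2 - d(x)\<^sup>2) = - dt/dx\<close>.
  Both claims become orthogonality relations of sines or cosines on \<open>[0, pi]\<close>.  The substitution
  need not be injective: only the values of an antiderivative at the two endpoints matter.
  Lebesgue integrability holds because \<open>t\<close> is continuous and, off finitely many points,
  differentiable with nonvanishing continuous derivative, hence piecewise monotone.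
\<close>

section \<open>Absolute integrability of a derivative that may be unbounded near finitely many
  points\<close>

text \<open>Without exceptional points, \<open>f'\<close> is continuous and nonvanishing on the open
  interval, so it has constant sign by connectedness. It is gauge integrable by the fundamental
  theorem, and constant sign turns this into absolute integrability. Induction on \<open>S\<close>
  splits the interval at one exceptional point at a time.\<close>

lemma absolutely_integrable_piecewise_monotone_deriv:
  fixes f f' :: "real \<Rightarrow> real"
  assumes "finite S" "a \<le> b" "continuous_on {a..b} f"
    and "\<And>x. x \<in> {a<..<b} - S \<Longrightarrow> (f has_real_derivative f' x) (at x)"
    and "\<And>x. x \<in> {a<..<b} - S \<Longrightarrow> isCont f' x"
    and "\<And>x. x \<in> {a<..<b} - S \<Longrightarrow> f' x \<noteq> 0"
  shows "f' absolutely_integrable_on {a..b}"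
  using assms
proof (induction S arbitrary: a b rule: finite_induct)
  case empty
  have "(f' has_integral (f b - f a)) {a..b}"
    using empty by (intro fundamental_theorem_of_calculus_interior)
      (auto simp: has_real_derivative_iff_has_vector_derivative)
  then have int: "f' integrable_on {a<..<b}"
    using has_integral_Icc_iff_Ioo by blast
  have cont: "continuous_on {a<..<b} f'"
    using empty by (auto intro!: continuous_at_imp_continuous_on)
  have conn: "connected (f' ` {a<..<b})"
    by (rule connected_continuous_image[OF cont]) simp
  have "(\<forall>x\<in>{a<..<b}. f' x \<ge> 0) \<or> (\<forall>x\<in>{a<..<b}. f' x \<le> 0)"
  proof (rule ccontr)
    assume "\<not> ?thesis"
    then obtain x y where "x \<in> {a<..<b}" "y \<in> {a<..<b}" "f' x < 0" "f' y > 0"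
      by force
    then have "0 \<in> f' ` {a<..<b}"
      using connectedD_interval[OF conn, of "f' x" "f' y" 0] by auto
    then show False using empty by auto
  qed
  then have "f' absolutely_integrable_on {a<..<b}"
  proof
    assume "\<forall>x\<in>{a<..<b}. f' x \<ge> 0"
    then show ?thesis using nonnegative_absolutely_integrable_1[OF int] by auto
  next
    assume "\<forall>x\<in>{a<..<b}. f' x \<le> 0"
    then have "(\<lambda>x. - f' x) absolutely_integrable_on {a<..<b}"
      using int by (intro nonnegative_absolutely_integrable_1) (auto intro: integrable_neg)
    from set_integrable_mult_right[of "-1", OF this] show ?thesis by simp
  qed
  then show ?case
    by (rule absolutely_integrable_spike_set)
       (auto intro!: negligible_subset[OF negligible_finite[of "{a, b}"]])
next
  case (insert s S)
  show ?case
  proof (cases "s \<in> {a<..<b}")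
    case True
    have "f' absolutely_integrable_on {a..s}"
      by (rule insert.IH)
         (use True insert.prems in \<open>auto elim: continuous_on_subset\<close>)
    moreover have "f' absolutely_integrable_on {s..b}"
      by (rule insert.IH)
         (use True insert.prems in \<open>auto elim: continuous_on_subset\<close>)
    ultimately show ?thesis
      by (rule absolutely_integrable_on_combine) (use True in auto)
  next
    case False
    show ?thesis
      by (rule insert.IH) (use False insert.prems in auto)
  qed
qed

section \<open>The substitution \<open>d(x) = R cos t\<close> in the integral\<close>

text \<open>Off finitely many points \<open>f\<close> is \<open>- poly q\<close> times the
  derivative of \<open>\<theta>\<close>, hence the derivative of \<open>H\<close> composed with
  \<open>\<theta>\<close>. The sign in the hypothesis on \<open>H\<close> reflects that arccos is
  decreasing.\<close>

lemma integral_cos_substitution: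
  fixes d q :: "real poly" and R a b :: real and H h :: "real \<Rightarrow> real"
  defines "\<theta> \<equiv> \<lambda>x. arccos (poly d x / R)"
    and "f \<equiv> \<lambda>x. poly q x / sqrt (R\<^sup>2 - (poly d x)\<^sup>2) * poly (pderiv d) x"
  assumes "a \<le> b" "R > 0" "degree d > 0"
    and bound: "\<And>x. x \<in> {a..b} \<Longrightarrow> \<bar>poly d x\<bar> \<le> R"
    and H: "\<And>t. (H has_real_derivative - h t) (at t)"
    and q: "\<And>x. x \<in> {a..b} \<Longrightarrow> poly q x = h (\<theta> x)"
  shows "interval_lebesgue_integrable lborel (ereal a) (ereal b) f"
    and "interval_lebesgue_integral lborel (ereal a) (ereal b) f = H (\<theta> b) - H (\<theta> a)"
proof -
  define w where "w = [:R\<^sup>2:] - d * d"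
  \<comment> \<open>The roots of \<open>w\<close> are the points where \<open>d\<close> takes the
    values \<open>R\<close> or \<open>- R\<close>, at which arccos is not differentiable. The roots
    of \<open>pderiv d\<close> are removed because the derivative of \<open>\<theta>\<close>
    vanishes there.\<close>
  define S where "S = {x. poly w x = 0} \<union> {x. poly (pderiv d) x = 0}"
  have w: "poly w x = R\<^sup>2 - (poly d x)\<^sup>2" for x
    by (simp add: w_def power2_eq_square)
  have "degree (d * d) > 0"
    using \<open>degree d > 0\<close> by (subst degree_mult_eq) auto
  then have "w \<noteq> 0"
    unfolding w_def by (metis degree_pCons_0 eq_iff_diff_eq_0 less_irrefl)
  moreover have "pderiv d \<noteq> 0"
    using \<open>degree d > 0\<close> by (simp add: pderiv_eq_0_iff)
  ultimately have "finite S"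
    unfolding S_def using poly_roots_finite by blast
  define \<theta>' where "\<theta>' = (\<lambda>x. - poly (pderiv d) x / sqrt (R\<^sup>2 - (poly d x)\<^sup>2))"
  have strict: "\<bar>poly d x\<bar> < R" if "x \<in> {a..b} - S" for x
  proof -
    have "poly d x \<noteq> R" "poly d x \<noteq> - R"
      using that w[of x] by (auto simp: S_def)
    then show ?thesis
      using bound[of x] that by force
  qed
  have pos: "R\<^sup>2 - (poly d x)\<^sup>2 > 0" if "x \<in> {a..b} - S" for x
    using power_strict_mono[OF strict[OF that], of 2] by simp
  have deriv: "(\<theta> has_real_derivative \<theta>' x) (at x)" if x: "x \<in> {a..b} - S" for x
  proof -
    have "sqrt (1 - (poly d x / R)\<^sup>2) = sqrt ((R\<^sup>2 - (poly d x)\<^sup>2) / R\<^sup>2)"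
      using \<open>R > 0\<close> by (simp add: field_simps)
    also have "\<dots> = sqrt (R\<^sup>2 - (poly d x)\<^sup>2) / R"
      using \<open>R > 0\<close> by (simp add: real_sqrt_divide)
    finally have s: "sqrt (1 - (poly d x / R)\<^sup>2) = sqrt (R\<^sup>2 - (poly d x)\<^sup>2) / R" .
    have "-1 < poly d x / R" "poly d x / R < 1"
      using strict[OF x] \<open>R > 0\<close> by (auto simp: field_simps abs_less_iff)
    then have "(\<theta> has_real_derivative
        inverse (- sqrt (1 - (poly d x / R)\<^sup>2)) * (poly (pderiv d) x / R)) (at x)"
      unfolding \<theta>_def
      by (intro DERIV_chain2[OF DERIV_arccos] DERIV_cdivide poly_DERIV)
    moreover have "inverse (- sqrt (1 - (poly d x / R)\<^sup>2)) * (poly (pderiv d) x / R) = \<theta>' x"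
      unfolding s \<theta>'_def using pos[OF x] \<open>R > 0\<close> by (simp add: field_simps)
    ultimately show ?thesis by simp
  qed
  have cont: "continuous_on {a..b} \<theta>"
    unfolding \<theta>_def using bound \<open>R > 0\<close>
    by (intro continuous_intros ballI) (auto simp: abs_le_iff pos_le_divide_eq minus_le_iff[of R])
  have "\<theta>' absolutely_integrable_on {a..b}"
  proof (rule absolutely_integrable_piecewise_monotone_deriv[OF \<open>finite S\<close> \<open>a \<le> b\<close> cont])
    fix x assume "x \<in> {a<..<b} - S"
    then have x: "x \<in> {a..b} - S" by auto
    show "(\<theta> has_real_derivative \<theta>' x) (at x)" by (rule deriv[OF x])
    show "isCont \<theta>' x"
      unfolding \<theta>'_def using pos[OF x] by (intro continuous_intros) auto
    show "\<theta>' x \<noteq> 0"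
      unfolding \<theta>'_def using pos[OF x] x by (auto simp: S_def)
  qed
  moreover have cq: "continuous_on {a..b} (\<lambda>x. - poly q x)"
    by (intro continuous_intros)
  \<comment> \<open>A polynomial is bounded on the compact interval, so multiplying by it preserves
    absolute integrability.\<close>
  ultimately have "(\<lambda>x. - poly q x * \<theta>' x) absolutely_integrable_on {a..b}"
    by (intro absolutely_integrable_bounded_measurable_product_real
        continuous_imp_measurable_on_sets_lebesgue compact_imp_bounded compact_continuous_image) auto
  moreover have "(\<lambda>x. - poly q x * \<theta>' x) = f"
    by (simp add: f_def \<theta>'_def fun_eq_iff)
  ultimately have "f absolutely_integrable_on {a..b}" by simp
  \<comment> \<open>Absolute integrability refers to the completed measure; Borel measurability is
    what allows the passage to \<open>lborel\<close>.\<close>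
  moreover have "(\<lambda>x. indicator {a..b} x *\<^sub>R f x) \<in> borel_measurable lborel"
  proof -
    have [measurable]: "poly p \<in> borel_measurable borel" for p :: "real poly"
      by (intro borel_measurable_continuous_onI continuous_intros)
    show ?thesis unfolding f_def by measurable
  qed
  ultimately have int: "set_integrable lborel {a..b} f"
    by (simp add: set_integrable_def integrable_completion)
  then have "set_integrable lborel {a<..<b} f"
    by (rule set_integrable_subset) auto
  then show "interval_lebesgue_integrable lborel (ereal a) (ereal b) f"
    using \<open>a \<le> b\<close> by (simp add: interval_lebesgue_integrable_def)
  have "(f has_integral (H (\<theta> b) - H (\<theta> a))) {a..b}"
  proof (rule fundamental_theorem_of_calculus_interior_strong[OF \<open>finite S\<close> \<open>a \<le> b\<close>])
    fix x assume "x \<in> {a<..<b} - S"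
    then have x: "x \<in> {a..b} - S" by auto
    have "((\<lambda>x. H (\<theta> x)) has_real_derivative - h (\<theta> x) * \<theta>' x) (at x)"
      by (rule DERIV_chain2[OF H deriv[OF x]])
    moreover have "- h (\<theta> x) * \<theta>' x = f x"
      using q[of x] x by (simp add: f_def \<theta>'_def)
    ultimately show "((\<lambda>x. H (\<theta> x)) has_vector_derivative f x) (at x)"
      by (simp add: has_real_derivative_iff_has_vector_derivative)
  next
    have "continuous_on UNIV H"
      by (rule DERIV_continuous_on[of _ _ "\<lambda>t. - h t"]) (use H in simp)
    then show "continuous_on {a..b} (\<lambda>x. H (\<theta> x))"
      by (rule continuous_on_compose2[OF _ cont]) auto
  qed
  then show "interval_lebesgue_integral lborel (ereal a) (ereal b) f = H (\<theta> b) - H (\<theta> a)"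
    using interval_integral_Icc[OF \<open>a \<le> b\<close>, of f] set_borel_integral_eq_integral(2)[OF int]
    by (simp add: integral_unique)
qed

text \<open>Exchanging the endpoints changes the sign of both the integral and the difference of
  \<open>H\<close>, which reduces the reversed case to the ordered one.\<close>

lemma oriented_integral_cos_substitution:
  fixes d q :: "real poly" and R a b :: real and H h :: "real \<Rightarrow> real"
  assumes "R > 0" "degree d > 0"
    and "\<And>x. x \<in> closed_segment a b \<Longrightarrow> \<bar>poly d x\<bar> \<le> R"
    and "\<And>t. (H has_real_derivative - h t) (at t)"
    and "\<And>x. x \<in> closed_segment a b \<Longrightarrow> poly q x = h (arccos (poly d x / R))"
  shows "has_oriented_integral
           (\<lambda>x. poly q x / sqrt (R\<^sup>2 - (poly d x)\<^sup>2) * poly (pderiv d) x) a b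
           (H (arccos (poly d b / R)) - H (arccos (poly d a / R)))"
proof (cases "a \<le> b")
  case True
  then show ?thesis
    unfolding has_oriented_integral_def
    using integral_cos_substitution[of a b R d H h q] assms
    by (auto simp: closed_segment_eq_real_ivl)
next
  case False
  then show ?thesis
    unfolding has_oriented_integral_def
    using integral_cos_substitution[of b a R d H h q] assms
    by (subst interval_integrable_endpoints_reverse, subst interval_integral_endpoints_reverse)
       (auto simp: closed_segment_eq_real_ivl)
qed

section \<open>Trigonometric form of both polynomial sequences\<close>

text \<open>For \<open>d(x) = 2 r cos t\<close> and \<open>g = - r^2\<close> the characteristic
  roots are \<open>r\<close> times exp(it) and exp(-it), which gives scaled Chebyshev polynomials of
  the second kind. The factor \<open>sin t * r\<close> avoids dividing by \<open>sin t\<close> and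
  the exponent \<open>n - 1\<close>.\<close>

lemma fibonacci_gfp_cos:
  assumes "poly d x = 2 * r * cos t"
  shows "sin t * r * poly (fibonacci_gfp d [:- (r\<^sup>2):] n) x = r ^ n * sin (n * t)"
proof -
  have rec: "2 * cos t * sin (real (Suc n) * t) - sin (real n * t) = sin (real (Suc (Suc n)) * t)"
    for n
    using sin_add[of "real (Suc n) * t" t] sin_diff[of "real (Suc n) * t" t] by (simp add: algebra_simps)
  show ?thesis unfolding fibonacci_gfp_def
  proof (induction n rule: induct_nat_012)
    case (ge2 n)
    have "sin t * r * poly (gfp 0 1 d [:- (r\<^sup>2):] (Suc (Suc n))) x
        = 2 * r * cos t * (sin t * r * poly (gfp 0 1 d [:- (r\<^sup>2):] (Suc n)) x)
          - r\<^sup>2 * (sin t * r * poly (gfp 0 1 d [:- (r\<^sup>2):] n) x)"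
      by (simp add: assms algebra_simps)
    also have "\<dots> = r ^ Suc (Suc n) * (2 * cos t * sin (real (Suc n) * t) - sin (real n * t))"
      unfolding ge2 by (simp add: algebra_simps power2_eq_square)
    finally show ?case unfolding rec .
  qed auto
qed

text \<open>These are scaled Chebyshev polynomials of the first kind; the relation between
  \<open>d\<close> and \<open>p1\<close> supplies the value at index 1.\<close>

lemma lucas_gfp_cos:
  assumes "poly d x = 2 * r * cos t" "lucas_params p0 p1 d"
  shows "poly (lucas_gfp p0 p1 d [:- (r\<^sup>2):] n) x = p0 * r ^ n * cos (n * t)"
proof -
  have rec: "2 * cos t * cos (real (Suc n) * t) - cos (real n * t) = cos (real (Suc (Suc n)) * t)"
    for n
    using cos_add[of "real (Suc n) * t" t] cos_diff[of "real (Suc n) * t" t] by (simp add: algebra_simps)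
  have "p0 \<noteq> 0" "d = smult (2 / p0) p1"
    using assms(2) by (auto simp: lucas_params_def)
  then have p1: "poly p1 x = p0 * r * cos t"
    using assms(1) by (auto simp: field_simps)
  show ?thesis unfolding lucas_gfp_def
  proof (induction n rule: induct_nat_012)
    case (ge2 n)
    have "poly (gfp [:p0:] p1 d [:- (r\<^sup>2):] (Suc (Suc n))) x
        = p0 * r ^ Suc (Suc n) * (2 * cos t * cos (real (Suc n) * t) - cos (real n * t))"
      using ge2 by (simp add: assms algebra_simps power2_eq_square)
    then show ?case unfolding rec .
  qed (auto simp: p1)
qed

section \<open>Orthogonality of the two sequences\<close>

lemma has_oriented_integral_cong:
  assumes "\<And>x. x \<in> closed_segment a b \<Longrightarrow> f x = g x"
  shows "has_oriented_integral f a b v \<longleftrightarrow> has_oriented_integral g a b v"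
proof -
  have eq: "f x = g x" if "x \<in> einterval (min a b) (max a b)" for x
    using that by (intro assms) (auto simp: closed_segment_eq_real_ivl einterval_iff min_def max_def
      split: if_splits)
  have "interval_lebesgue_integrable lborel (ereal a) (ereal b) f
      \<longleftrightarrow> interval_lebesgue_integrable lborel (ereal a) (ereal b) g"
    unfolding interval_lebesgue_integrable_def using eq
    by (intro if_cong refl set_integrable_cong) (auto simp: min_def max_def)
  moreover have "interval_lebesgue_integral lborel (ereal a) (ereal b) f
      = interval_lebesgue_integral lborel (ereal a) (ereal b) g"
    using eq by (intro interval_integral_cong) (simp add: ereal_min ereal_max)
  ultimately show ?thesis
    by (simp add: has_oriented_integral_def)
qed

theorem proposition3p6:
  fixes k s1 s2 p0 :: real and d g p1 :: "real poly" and n m :: nat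
  assumes "k < 0"
    and "g = [:k:]"
    and "\<forall>i. coeff d i \<in> \<rat>"
    and "degree d > 0"
    and "lucas_params p0 p1 d"
    and "poly d s1 = - sqrt (- 4 * k)"
    and "poly d s2 = sqrt (- 4 * k)"
    and "\<forall>x \<in> closed_segment s1 s2. 4 * k + (poly d x)\<^sup>2 \<le> 0"
    and "n \<noteq> m"
  shows "has_oriented_integral
           (\<lambda>x. poly (fibonacci_gfp d g n) x * poly (fibonacci_gfp d g m) x
                 * sqrt (- 4 * k - (poly d x)\<^sup>2) * poly (pderiv d) x) s1 s2 0
       \<and> has_oriented_integral
           (\<lambda>x. poly (lucas_gfp p0 p1 d g n) x * poly (lucas_gfp p0 p1 d g m) x
                 / sqrt (- 4 * k - (poly d x)\<^sup>2) * poly (pderiv d) x) s1 s2 0"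
proof -
  define r where "r = sqrt (- k)"
  define R where "R = 2 * r"
  have "r > 0" "R > 0" and k: "k = - (r\<^sup>2)"
    using \<open>k < 0\<close> by (auto simp: r_def R_def)
  have R: "sqrt (- 4 * k) = R" "- 4 * k = R\<^sup>2"
    using \<open>r > 0\<close> by (auto simp: R_def k real_sqrt_mult power2_eq_square)
  have g: "g = [:- (r\<^sup>2):]"
    using assms(2) k by simp
  have bound: "\<bar>poly d x\<bar> \<le> R" if "x \<in> closed_segment s1 s2" for x
  proof -
    have "(poly d x)\<^sup>2 \<le> R\<^sup>2"
      using assms(8) that R(2) by fastforce
    then show ?thesis
      using \<open>R > 0\<close> by (simp add: abs_le_square_iff[symmetric])
  qed
  define t where "t = (\<lambda>x. arccos (poly d x / R))"
  have dt: "poly d x = 2 * r * cos (t x)" if "x \<in> closed_segment s1 s2" for x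
    using bound[OF that] \<open>R > 0\<close> unfolding t_def
    by (subst cos_arccos) (auto simp: R_def field_simps abs_le_iff)
  \<comment> \<open>By the product-to-sum formulas, the bracket is twice a product of sines for
    \<open>s = -1\<close> and twice a product of cosines for \<open>s = 1\<close>. \<open>H\<close>
    is an antiderivative of \<open>- h\<close>; its denominators are nonzero because
    \<open>n\<close> and \<open>m\<close> are distinct naturals.\<close>
  define h where "h = (\<lambda>c s u. c * (cos ((real n - real m) * u) + s * cos ((real n + real m) * u)))"
  define H where "H = (\<lambda>c s u. - c * (sin ((real n - real m) * u) / (real n - real m)
                          + s * (sin ((real n + real m) * u) / (real n + real m))))"
  have H_deriv: "(H c s has_real_derivative - h c s u) (at u)" for c s u
  proof -
    have "((\<lambda>u. - c * (sin (\<alpha> * u) / \<alpha> + s * (sin (\<beta> * u) / \<beta>)))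
        has_real_derivative - (c * (cos (\<alpha> * u) + s * cos (\<beta> * u)))) (at u)"
      if "\<alpha> \<noteq> 0" "\<beta> \<noteq> 0" for \<alpha> \<beta> :: real
      using that by (auto intro!: derivative_eq_intros simp: field_simps)
    from this[of "real n - real m" "real n + real m"] show ?thesis
      unfolding H_def h_def using \<open>n \<noteq> m\<close> by force
  qed
  \<comment> \<open>The two arccos values are 0 and \<open>pi\<close>, where sines of integer
    multiples vanish.\<close>
  have H_zero: "H c s (arccos (poly d s2 / R)) - H c s (arccos (poly d s1 / R)) = 0" for c s
    using \<open>R > 0\<close>
    by (simp add: assms(6,7) R(1)[simplified] H_def left_diff_distrib distrib_right sin_diff sin_add)
  have zero: "has_oriented_integral
      (\<lambda>x. poly q x / sqrt (R\<^sup>2 - (poly d x)\<^sup>2) * poly (pderiv d) x) s1 s2 0"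
    if "\<And>x. x \<in> closed_segment s1 s2 \<Longrightarrow> poly q x = h c s (t x)" for q c s
    using oriented_integral_cos_substitution[where a = s1 and b = s2, OF \<open>R > 0\<close> \<open>degree d > 0\<close>
        bound H_deriv that[unfolded t_def]]
    unfolding H_zero by simp
  let ?F = "fibonacci_gfp d g" and ?L = "lucas_gfp p0 p1 d g"
  have "has_oriented_integral
      (\<lambda>x. poly (?F n * ?F m * ([:R\<^sup>2:] - d * d)) x / sqrt (R\<^sup>2 - (poly d x)\<^sup>2)
            * poly (pderiv d) x) s1 s2 0"
  \<comment> \<open>The extra factor \<open>R^2 - d^2\<close> equals \<open>(2 r sin t)^2\<close>;
    it supplies one factor \<open>sin t * r\<close> to each Fibonacci polynomial.\<close>
  proof (rule zero[where c = "2 * r ^ (n + m)" and s = "-1"])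
    fix x assume x: "x \<in> closed_segment s1 s2"
    have "R\<^sup>2 - (poly d x)\<^sup>2 = 4 * (sin (t x) * r)\<^sup>2"
      unfolding dt[OF x] R_def by (simp add: sin_squared_eq algebra_simps power_mult_distrib)
    then have "poly (?F n * ?F m * ([:R\<^sup>2:] - d * d)) x
        = 4 * (sin (t x) * r * poly (?F n) x) * (sin (t x) * r * poly (?F m) x)"
      by (simp add: power2_eq_square)
    also have "\<dots> = 4 * r ^ (n + m) * (sin (n * t x) * sin (m * t x))"
      unfolding g fibonacci_gfp_cos[OF dt[OF x]] by (simp add: power_add)
    also have "\<dots> = h (2 * r ^ (n + m)) (- 1) (t x)"
      by (simp add: h_def left_diff_distrib distrib_right cos_diff cos_add)
    finally show "poly (?F n * ?F m * ([:R\<^sup>2:] - d * d)) x = h (2 * r ^ (n + m)) (- 1) (t x)" .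
  qed
  moreover have "poly (?F n) x * poly (?F m) x * sqrt (- 4 * k - (poly d x)\<^sup>2) * poly (pderiv d) x
      = poly (?F n * ?F m * ([:R\<^sup>2:] - d * d)) x / sqrt (R\<^sup>2 - (poly d x)\<^sup>2) * poly (pderiv d) x"
    if "x \<in> closed_segment s1 s2" for x
  proof -
    have "R\<^sup>2 - (poly d x)\<^sup>2 \<ge> 0"
      using bound[OF that] \<open>R > 0\<close> by (simp add: abs_le_square_iff[symmetric])
    \<comment> \<open>This also holds where the radicand vanishes, since division by 0 yields
      0.\<close>
    then have sqrt: "sqrt (R\<^sup>2 - (poly d x)\<^sup>2) = (R\<^sup>2 - (poly d x)\<^sup>2) / sqrt (R\<^sup>2 - (poly d x)\<^sup>2)"
      by (simp add: real_div_sqrt)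
    show ?thesis
      unfolding R(2) by (subst sqrt) (simp add: power2_eq_square)
  qed
  ultimately have "has_oriented_integral
      (\<lambda>x. poly (?F n) x * poly (?F m) x * sqrt (- 4 * k - (poly d x)\<^sup>2) * poly (pderiv d) x) s1 s2 0"
    by (subst has_oriented_integral_cong)
  moreover have "has_oriented_integral
      (\<lambda>x. poly (?L n * ?L m) x / sqrt (R\<^sup>2 - (poly d x)\<^sup>2) * poly (pderiv d) x) s1 s2 0"
  \<comment> \<open>Each Lucas polynomial contributes a factor \<open>p0\<close>; the 2 comes from
    the product-to-sum formula.\<close>
  proof (rule zero[where c = "p0\<^sup>2 * r ^ (n + m) / 2" and s = 1])
    fix x assume x: "x \<in> closed_segment s1 s2"
    show "poly (?L n * ?L m) x = h (p0\<^sup>2 * r ^ (n + m) / 2) 1 (t x)"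
      unfolding g poly_mult lucas_gfp_cos[OF dt[OF x] assms(5)]
      by (simp add: h_def left_diff_distrib distrib_right cos_diff cos_add power_add power2_eq_square)
  qed
  ultimately show ?thesis
    unfolding R(2) by simp
qed

end
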